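(* Assume: (A1) $\Psi(s-t)=\phi(\|s-t\|_2)$, where $\phi(r)>0$ is a strictly decreasing function of $r\in\mathbb{R}^+$ with $\phi(0)=1$, and the reproducing kernel Hilbert space generated by $\Psi$ can be embedded into a Sobolev space $H^{\nu}(\Omega)$ with $\nu>d/2$; (A2) the design points $X=X_m=\{x_1,\ldots,x_{n_m}\}\subset\Omega$, $m=1,2,\ldots$, satisfy $h_{X_m}\le C q_{X_m}$ for all $m$, for some constant $C>0$ independent of $m$. Then, for $x\in\Omega$, the mean squared prediction error of KALEN, $$\mathbb{E}(y(x)-\hat y(x))^2=\sigma^2\Psi(x-x)-r_N(x)^TK^{-1}r_N(x),$$ converges to $\sigma^2(\Psi(x-x)-\Psi_S(x-x))$ as the fill distance $h_X$ of the design points converges to zero, where $$\Psi_S(s-t)=\iint\Psi(s+\epsilon_1-(t+\epsilon_2))\,p(\epsilon_1)p(\epsilon_2)\,d\epsilon_1 d\epsilon_2.$$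
   Context: Setting (Gaussian process with input location error). $\Omega\subset\mathbb{R}^d$ is convex and compact. $f$ is a stationary Gaussian process on $\mathbb{R}^d$ with mean zero and covariance $\mathrm{Cov}(f(x),f(x'))=\sigma^2\Psi(x-x')$, where $\sigma^2>0$ and $\Psi\in L_1(\mathbb{R}^d)\cap C(\mathbb{R}^d)$ is a positive definite correlation function, $\Psi(0)=1$ (so $\Psi(x-x)=1$). One observes $y_j=f(x_j+\epsilon_j)$ at design points $X=\{x_1,\ldots,x_n\}\subset\Omega$, where the $\epsilon_j$ are i.i.d. random vectors in $\mathbb{R}^d$, independent of $f$, with mean $0$ and continuous probability density $p(\cdot)$, each component having finite variance. Replicates are allowed: $x_j=x_k$ may hold for $j\ne k$ (with separate noises $\epsilon_j,\epsilon_k$). $Y=(y_1,\ldots,y_n)^T$. KALEN (Kriging adjusting for location error and noise) is the best linear unbiased predictor of $y(x)=f(x+\epsilon)$, where $\epsilon$ has density $p$ and is independent of $f$ and of the $\epsilon_j$: $\hat y(x)=r_N(x)^TK^{-1}Y$, with $r_N(x)=(r_N(x,x_1),\ldots,r_N(x,x_n))^T$, $r_N(x,x_j)=\sigma^2\Psi_S(x-x_j)$, and $K=(K_{jk})$, $K_{jj}=\sigma^2\Psi(0)=\sigma^2$, $K_{jk}=\sigma^2\Psi_S(x_j-x_k)$ for $j\ne k$. Fill distance: $h_X=\sup_{x\in\Omega}\min_{x_j\in X}\|x-x_j\|_2$. Separation: $q_X=\min_{x_j\ne x_k,\ x_j,x_k\in X}\|x_j-x_k\|_2/2$ (minimum over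 distinct points). RKHS: with $\mathcal{F}(g)(\omega)=(2\pi)^{-d/2}\int_{\mathbb{R}^d}g(x)e^{-ix^T\omega}dx$, $\mathcal{N}_\Psi(\mathbb{R}^d)=\{g\in L_2(\mathbb{R}^d)\cap C(\mathbb{R}^d):\mathcal{F}(g)/\sqrt{\mathcal{F}(\Psi)}\in L_2(\mathbb{R}^d)\}$ with $\langle g_1,g_2\rangle=(2\pi)^{-d/2}\int \mathcal{F}(g_1)\overline{\mathcal{F}(g_2)}/\mathcal{F}(\Psi)$; $\mathcal{N}_\Psi(\Omega)$ consists of restrictions to $\Omega$ with norm $\|g\|=\inf\{\|g_E\|_{\mathcal{N}_\Psi(\mathbb{R}^d)}:g_E|_\Omega=g\}$. $H^\nu(\Omega)$ is defined likewise by restriction from $H^\nu(\mathbb{R}^d)=\{g\in L_2: |\mathcal{F}(g)|(1+\|\cdot\|_2^2)^{\nu/2}\in L_2\}$. *)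

theory Defs
  imports "HOL-Probability.Probability" "Jordan_Normal_Form.Gauss_Jordan_Elimination"
begin

no_notation inner (infix "\<bullet>" 70)

text \<open>The space R^d is an arbitrary type \<open>'a :: euclidean_space\<close>, with d = DIM('a) and with
  coordinates taken along \<open>Basis\<close>. A design with n points, repetitions allowed, is a family
  \<open>xs j\<close> with \<open>j < n\<close>.\<close>


subsection \<open>Fill distance and separation radius\<close>

definition fill_distance :: "'a::euclidean_space set \<Rightarrow> 'a set \<Rightarrow> real" where
  "fill_distance \<Omega> X = (SUP x\<in>\<Omega>. Min ((\<lambda>y. dist x y) ` X))"

text \<open>The minimum exists only if the finite set \<open>X\<close> has at least two elements; otherwise the
  value is unspecified.\<close>

definition separation_radius :: "'a::euclidean_space set \<Rightarrow> real" where
  "separation_radius X = Min {dist y z | y z. y \<in> X \<and> z \<in> X \<and> y \<noteq> z} / 2"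


subsection \<open>Fourier transform on $L_2$, native spaces and Sobolev spaces\<close>

definition square_integrable :: "('a::euclidean_space \<Rightarrow> 'b::real_normed_vector) \<Rightarrow> bool" where
  "square_integrable g \<longleftrightarrow>
     g \<in> borel_measurable borel \<and> integrable lborel (\<lambda>x. (norm (g x))\<^sup>2)"

definition fourier :: "('a::euclidean_space \<Rightarrow> real) \<Rightarrow> 'a \<Rightarrow> complex" where
  "fourier g w = complex_of_real ((2 * pi) powr (- real DIM('a) / 2)) *
     (LINT x|lborel. complex_of_real (g x) * exp (- (\<i> * complex_of_real (inner x w))))"

text \<open>For g in $L_2$, which need not be integrable, the Fourier transform is the $L_2$ limit of the
  transforms of the truncations of g to balls (Plancherel). It is determined only up to null sets,
  and all uses below are invariant under such changes.\<close>

definition fourier_L2 :: "('a::euclidean_space \<Rightarrow> real) \<Rightarrow> 'a \<Rightarrow> complex" where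
  "fourier_L2 g = (SOME G. square_integrable G \<and>
     ((\<lambda>R::real. \<integral>\<^sup>+ w. ennreal ((norm (fourier (\<lambda>x. indicator (cball 0 R) x * g x) w - G w))\<^sup>2) \<partial>lborel)
        \<longlongrightarrow> 0) at_top)"

text \<open>The transform of \<open>\<Psi>\<close> is real and nonnegative for positive definite even \<open>\<Psi>\<close>.
  In \<open>ennreal\<close>, 0 / 0 = 0 and a / 0 = \<open>\<infinity>\<close> for a > 0, so finiteness of the following integral
  forces the transform of g to vanish almost everywhere where that of \<open>\<Psi>\<close> does.\<close>

definition native_energy :: "('a::euclidean_space \<Rightarrow> real) \<Rightarrow> ('a \<Rightarrow> real) \<Rightarrow> ennreal" where
  "native_energy \<Psi> g =
     (\<integral>\<^sup>+ w. ennreal ((norm (fourier_L2 g w))\<^sup>2) / ennreal (Re (fourier \<Psi> w)) \<partial>lborel)"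

definition native_space :: "('a::euclidean_space \<Rightarrow> real) \<Rightarrow> ('a \<Rightarrow> real) set" where
  "native_space \<Psi> = {g. square_integrable g \<and> continuous_on UNIV g \<and> native_energy \<Psi> g < \<infinity>}"

definition native_norm :: "('a::euclidean_space \<Rightarrow> real) \<Rightarrow> ('a \<Rightarrow> real) \<Rightarrow> real" where
  "native_norm \<Psi> g =
     sqrt ((2 * pi) powr (- real DIM('a) / 2) * enn2real (native_energy \<Psi> g))"

definition sobolev_energy :: "real \<Rightarrow> ('a::euclidean_space \<Rightarrow> real) \<Rightarrow> ennreal" where
  "sobolev_energy \<nu> g =
     (\<integral>\<^sup>+ w. ennreal ((norm (fourier_L2 g w) * (1 + (norm w)\<^sup>2) powr (\<nu> / 2))\<^sup>2) \<partial>lborel)"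

definition sobolev_space :: "real \<Rightarrow> ('a::euclidean_space \<Rightarrow> real) set" where
  "sobolev_space \<nu> = {g. square_integrable g \<and> sobolev_energy \<nu> g < \<infinity>}"

definition sobolev_norm :: "real \<Rightarrow> ('a::euclidean_space \<Rightarrow> real) \<Rightarrow> real" where
  "sobolev_norm \<nu> g = sqrt (enn2real (sobolev_energy \<nu> g))"

text \<open>Functions on \<open>\<Omega>\<close> are total functions of which only the values on \<open>\<Omega>\<close> matter.\<close>

definition restriction_space :: "'a set \<Rightarrow> ('a \<Rightarrow> real) set \<Rightarrow> ('a \<Rightarrow> real) set" where
  "restriction_space \<Omega> H = {g. \<exists>gE\<in>H. \<forall>x\<in>\<Omega>. gE x = g x}"

definition restriction_norm ::
    "'a set \<Rightarrow> ('a \<Rightarrow> real) set \<Rightarrow> (('a \<Rightarrow> real) \<Rightarrow> real) \<Rightarrow> ('a \<Rightarrow> real) \<Rightarrow> real" where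
  "restriction_norm \<Omega> H N g = (INF gE\<in>{gE\<in>H. \<forall>x\<in>\<Omega>. gE x = g x}. N gE)"

definition native_embeds_in_sobolev ::
    "'a::euclidean_space set \<Rightarrow> ('a \<Rightarrow> real) \<Rightarrow> real \<Rightarrow> bool" where
  "native_embeds_in_sobolev \<Omega> \<Psi> \<nu> \<longleftrightarrow>
     (\<exists>c. \<forall>g\<in>restriction_space \<Omega> (native_space \<Psi>).
        g \<in> restriction_space \<Omega> (sobolev_space \<nu>) \<and>
        restriction_norm \<Omega> (sobolev_space \<nu>) (sobolev_norm \<nu>) g
          \<le> c * restriction_norm \<Omega> (native_space \<Psi>) (native_norm \<Psi>) g)"


subsection \<open>Gaussian process and location errors\<close>

definition positive_definite :: "('a::euclidean_space \<Rightarrow> real) \<Rightarrow> bool" where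
  "positive_definite \<Psi> \<longleftrightarrow> (\<forall>T c. finite T \<and> (\<exists>s\<in>T. c s \<noteq> 0) \<longrightarrow>
     0 < (\<Sum>s\<in>T. \<Sum>t\<in>T. c s * c t * \<Psi> (s - t)))"

text \<open>Degenerate (almost surely constant) variables count as Gaussian.\<close>

definition gaussian_variable :: "'w measure \<Rightarrow> ('w \<Rightarrow> real) \<Rightarrow> bool" where
  "gaussian_variable M Z \<longleftrightarrow> Z \<in> borel_measurable M \<and>
     ((\<exists>\<mu> s. 0 < s \<and> distributed M lborel Z (\<lambda>z. ennreal (normal_density \<mu> s z))) \<or>
      (\<exists>\<mu>. AE \<omega> in M. Z \<omega> = \<mu>))"

definition gaussian_process :: "'w measure \<Rightarrow> ('a \<Rightarrow> 'w \<Rightarrow> real) \<Rightarrow> bool" where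
  "gaussian_process M f \<longleftrightarrow>
     (\<forall>T c. finite T \<longrightarrow> gaussian_variable M (\<lambda>\<omega>. \<Sum>t\<in>T. c t * f t \<omega>))"

definition covariance :: "'w measure \<Rightarrow> ('w \<Rightarrow> real) \<Rightarrow> ('w \<Rightarrow> real) \<Rightarrow> real" where
  "covariance M Y Z =
     (LINT \<omega>|M. (Y \<omega> - integral\<^sup>L M Y) * (Z \<omega> - integral\<^sup>L M Z))"

text \<open>The \<open>\<sigma>\<close>-algebra generated by the process, and joint measurability of the process in
  (space, chance) with respect to it. The latter makes f(x + \<open>\<epsilon>\<close>) a random variable whose law
  can be computed by conditioning on \<open>\<epsilon>\<close>. It holds when the paths are continuous, and any process
  with continuous covariance has a modification with this property.\<close>

definition process_algebra :: "'w measure \<Rightarrow> ('a \<Rightarrow> 'w \<Rightarrow> real) \<Rightarrow> 'w measure" where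
  "process_algebra M f =
     vimage_algebra (space M) (\<lambda>\<omega> x. f x \<omega>) (\<Pi>\<^sub>M x\<in>UNIV. (borel :: real measure))"

definition measurable_process :: "'w measure \<Rightarrow> ('a::euclidean_space \<Rightarrow> 'w \<Rightarrow> real) \<Rightarrow> bool" where
  "measurable_process M f \<longleftrightarrow>
     (\<lambda>(x, \<omega>). f x \<omega>) \<in> borel_measurable (borel \<Otimes>\<^sub>M process_algebra M f)"

definition iid_location_errors ::
    "'w measure \<Rightarrow> ('a::euclidean_space \<Rightarrow> real) \<Rightarrow> 'i set \<Rightarrow> ('i \<Rightarrow> 'w \<Rightarrow> 'a) \<Rightarrow> bool" where
  "iid_location_errors M p J e \<longleftrightarrow>
     prob_space.indep_vars M (\<lambda>_. borel) e J \<and>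
     (\<forall>j\<in>J. distributed M lborel (e j) (\<lambda>v. ennreal (p v)) \<and>
        (\<forall>b\<in>Basis. integrable M (\<lambda>\<omega>. (inner (e j \<omega>) b)\<^sup>2) \<and>
                    (LINT \<omega>|M. inner (e j \<omega>) b) = 0))"

definition independent_of_process ::
    "'w measure \<Rightarrow> ('a::euclidean_space \<Rightarrow> 'w \<Rightarrow> real) \<Rightarrow> 'i set \<Rightarrow> ('i \<Rightarrow> 'w \<Rightarrow> 'a) \<Rightarrow> bool" where
  "independent_of_process M f J e \<longleftrightarrow>
     prob_space.indep_set M (sets (process_algebra M f))
       (sets (vimage_algebra (space M) (\<lambda>\<omega>. \<lambda>j\<in>J. e j \<omega>) (\<Pi>\<^sub>M j\<in>J. (borel :: 'a measure))))"


subsection \<open>KALEN\<close>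

text \<open>As a function of h = s - t, since s + e1 - (t + e2) = h + e1 - e2.\<close>

definition Psi_S :: "('a::euclidean_space \<Rightarrow> real) \<Rightarrow> ('a \<Rightarrow> real) \<Rightarrow> 'a \<Rightarrow> real" where
  "Psi_S \<Psi> p h = (LINT e1|lborel. (LINT e2|lborel. \<Psi> (h + e1 - e2) * p e1 * p e2))"

definition kalen_r ::
    "real \<Rightarrow> ('a::euclidean_space \<Rightarrow> real) \<Rightarrow> ('a \<Rightarrow> real) \<Rightarrow> nat \<Rightarrow> (nat \<Rightarrow> 'a) \<Rightarrow> 'a \<Rightarrow> real vec" where
  "kalen_r \<sigma> \<Psi> p n xs x = vec n (\<lambda>j. \<sigma>\<^sup>2 * Psi_S \<Psi> p (x - xs j))"

definition kalen_K ::
    "real \<Rightarrow> ('a::euclidean_space \<Rightarrow> real) \<Rightarrow> ('a \<Rightarrow> real) \<Rightarrow> nat \<Rightarrow> (nat \<Rightarrow> 'a) \<Rightarrow> real mat" where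
  "kalen_K \<sigma> \<Psi> p n xs =
     mat n n (\<lambda>(j, k). if j = k then \<sigma>\<^sup>2 * \<Psi> 0 else \<sigma>\<^sup>2 * Psi_S \<Psi> p (xs j - xs k))"

text \<open>Unspecified when the matrix is singular.\<close>

definition inverse_mat :: "real mat \<Rightarrow> real mat" where
  "inverse_mat A = the (mat_inverse A)"

definition kalen_predictor ::
    "real \<Rightarrow> ('a::euclidean_space \<Rightarrow> real) \<Rightarrow> ('a \<Rightarrow> real) \<Rightarrow> nat \<Rightarrow> (nat \<Rightarrow> 'a) \<Rightarrow> 'a \<Rightarrow> real vec \<Rightarrow> real"
  where
  "kalen_predictor \<sigma> \<Psi> p n xs x Y =
     scalar_prod (kalen_r \<sigma> \<Psi> p n xs x) (inverse_mat (kalen_K \<sigma> \<Psi> p n xs) *\<^sub>v Y)"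

definition observations ::
    "('a::euclidean_space \<Rightarrow> 'w \<Rightarrow> real) \<Rightarrow> nat \<Rightarrow> (nat \<Rightarrow> 'a) \<Rightarrow> (nat \<Rightarrow> 'w \<Rightarrow> 'a) \<Rightarrow> 'w \<Rightarrow> real vec" where
  "observations f n xs \<epsilon> \<omega> = vec n (\<lambda>j. f (xs j + \<epsilon> j \<omega>) \<omega>)"

text \<open>Here \<open>\<epsilon>\<^sub>0\<close> is the location error at the prediction point x.\<close>

definition kalen_mspe ::
    "'w measure \<Rightarrow> ('a::euclidean_space \<Rightarrow> 'w \<Rightarrow> real) \<Rightarrow> real \<Rightarrow> ('a \<Rightarrow> real) \<Rightarrow> ('a \<Rightarrow> real) \<Rightarrow>
     nat \<Rightarrow> (nat \<Rightarrow> 'a) \<Rightarrow> (nat \<Rightarrow> 'w \<Rightarrow> 'a) \<Rightarrow> ('w \<Rightarrow> 'a) \<Rightarrow> 'a \<Rightarrow> real" where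
  "kalen_mspe M f \<sigma> \<Psi> p n xs \<epsilon> \<epsilon>\<^sub>0 x =
     (LINT \<omega>|M. (f (x + \<epsilon>\<^sub>0 \<omega>) \<omega> - kalen_predictor \<sigma> \<Psi> p n xs x (observations f n xs \<epsilon> \<omega>))\<^sup>2)"

end

theory Submission
  imports Defs "Jordan_Normal_Form.Determinant"
begin

text \<open>Write \<open>S\<close> for the correlation smoothed by two independent errors. Since an error at one point
  is shared only with itself, \<open>K / \<sigma>\<^sup>2\<close> is the positive semidefinite matrix of \<open>S\<close> plus \<open>1 - S 0 > 0\<close> times
  the identity: a nugget. The nugget of the predicted value cannot be predicted, so \<open>\<sigma>\<^sup>2 * (1 - S 0)\<close>
  bounds the error from below. Conversely, KALEN is at least as good as the average of \<open>k\<close>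
  observations near \<open>x\<close>, whose relative error is close to \<open>(1 - S 0) * (1 + 1 / k)\<close> by continuity of \<open>S\<close>;
  as the fill distance vanishes, \<open>k\<close> can be taken arbitrarily large.\<close>

section \<open>Linear algebra of positive definite forms\<close>

text \<open>A kernel vector would annihilate the quadratic form, so the determinant is nonzero. Then
  \<open>mat_inverse\<close> returns a genuine inverse, which gives the unspecified case of
  \<open>inverse_mat\<close> no room.\<close>

lemma inverse_mat_positive_definite:
  fixes k :: "nat \<Rightarrow> nat \<Rightarrow> real"
  assumes pd: "\<And>c. \<exists>i<n. c i \<noteq> 0 \<Longrightarrow> 0 < (\<Sum>i<n. \<Sum>j<n. c i * c j * k i j)"
  defines "A \<equiv> mat n n (\<lambda>(i, j). k i j)"
  shows "invertible_mat A" "A * inverse_mat A = 1\<^sub>m n" "inverse_mat A * A = 1\<^sub>m n"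
    "inverse_mat A \<in> carrier_mat n n"
proof -
  have A: "A \<in> carrier_mat n n" by (simp add: A_def)
  have "Determinant.det A \<noteq> 0"
  proof
    assume "Determinant.det A = 0"
    then obtain v where v: "v \<in> carrier_vec n" "v \<noteq> 0\<^sub>v n" "A *\<^sub>v v = 0\<^sub>v n"
      using det_0_iff_vec_prod_zero_field[OF A] by auto
    from v(1,2) have "\<exists>i<n. v $ i \<noteq> 0" by (metis eq_vecI index_zero_vec carrier_vecD)
    from pd[OF this] have "0 < (\<Sum>i<n. v $ i * (\<Sum>j<n. k i j * v $ j))"
      by (simp add: sum_distrib_left mult_ac)
    also have "(\<Sum>i<n. v $ i * (\<Sum>j<n. k i j * v $ j)) = (\<Sum>i<n. v $ i * (A *\<^sub>v v) $ i)"
      using v(1) by (intro sum.cong) (auto simp: A_def scalar_prod_def lessThan_atLeast0)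
    also have "\<dots> = 0" using v(3) by simp
    finally show False by simp
  qed
  hence "A \<in> Units (ring_mat TYPE(real) n ())" by (rule det_non_zero_imp_unit[OF A])
  with mat_inverse(1)[OF A, where b = "()"] obtain B where B: "mat_inverse A = Some B" by auto
  have *: "A * B = 1\<^sub>m n \<and> B * A = 1\<^sub>m n \<and> B \<in> carrier_mat n n"
    by (rule mat_inverse(2)[OF A B])
  show "A * inverse_mat A = 1\<^sub>m n" "inverse_mat A * A = 1\<^sub>m n" "inverse_mat A \<in> carrier_mat n n"
    using * B by (simp_all add: inverse_mat_def)
  show "invertible_mat A" unfolding invertible_mat_def inverts_mat_def square_mat.simps
    using A * by auto
qed

text \<open>The transpose of \<open>B\<close> is a left inverse of the symmetric matrix
  \<open>A\<close>, hence equals the right inverse \<open>B\<close>. This lets the inverse pass from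
  the data to the covariance vector, exposing the weights of the predictor.\<close>

lemma scalar_prod_inverse_mat_symmetric:
  fixes A :: "real mat"
  assumes A: "A \<in> carrier_mat n n" "transpose_mat A = A"
    and B: "A * B = 1\<^sub>m n" "B \<in> carrier_mat n n"
    and u: "u \<in> carrier_vec n" "v \<in> carrier_vec n"
  shows "scalar_prod u (B *\<^sub>v v) = scalar_prod (B *\<^sub>v u) v"
proof -
  have "transpose_mat B * A = 1\<^sub>m n"
    using transpose_mult[OF A(1) B(2)] A(2) B(1) by simp
  hence "transpose_mat B * A * B = B" using B by simp
  hence "transpose_mat B = B"
    using assoc_mult_mat[of "transpose_mat B" n n A n B n] A B by simp
  thus ?thesis using transpose_vec_mult_scalar[OF B(2) u(2,1)] by simp
qed

text \<open>Completing the square: by the normal equations \<open>sol\<close>, the two sides of the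
  inequality differ by the form evaluated at \<open>c - w\<close>, which is nonnegative.\<close>

lemma quadratic_form_minimum:
  fixes k :: "nat \<Rightarrow> nat \<Rightarrow> real"
  assumes sym: "\<And>i j. k i j = k j i"
    and psd: "\<And>d. 0 \<le> (\<Sum>i<n. \<Sum>j<n. d i * d j * k i j)"
    and sol: "\<And>i. i < n \<Longrightarrow> (\<Sum>j<n. k i j * w j) = r i"
  shows "(\<Sum>i<n. \<Sum>j<n. w i * w j * k i j) = (\<Sum>i<n. w i * r i)"
    and "(\<Sum>i<n. \<Sum>j<n. w i * w j * k i j) - 2 * (\<Sum>i<n. w i * r i)
      \<le> (\<Sum>i<n. \<Sum>j<n. c i * c j * k i j) - 2 * (\<Sum>i<n. c i * r i)"
proof -
  have r: "(\<Sum>i<n. \<Sum>j<n. d i * w j * k i j) = (\<Sum>i<n. d i * r i)" for d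
    by (intro sum.cong refl) (simp add: sol[symmetric] sum_distrib_left mult_ac)
  show "(\<Sum>i<n. \<Sum>j<n. w i * w j * k i j) = (\<Sum>i<n. w i * r i)" by (rule r)
  have "(\<Sum>i<n. \<Sum>j<n. w i * c j * k i j) = (\<Sum>i<n. \<Sum>j<n. c i * w j * k i j)"
    by (subst sum.swap) (simp add: sym mult_ac)
  moreover have "0 \<le> (\<Sum>i<n. \<Sum>j<n. (c i - w i) * (c j - w j) * k i j)" by (rule psd)
  ultimately show "(\<Sum>i<n. \<Sum>j<n. w i * w j * k i j) - 2 * (\<Sum>i<n. w i * r i)
      \<le> (\<Sum>i<n. \<Sum>j<n. c i * c j * k i j) - 2 * (\<Sum>i<n. c i * r i)"
    using r[of w] r[of c] by (simp add: algebra_simps sum.distrib sum_subtractf)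
qed

section \<open>Small fill distance yields many nearby design points\<close>

text \<open>A real supremum dominates its members only when they are bounded above; the distance to
  one fixed design point supplies the bound.\<close>

lemma Min_dist_le_fill_distance:
  fixes \<Omega> X :: "'a::euclidean_space set"
  assumes "bounded \<Omega>" "finite X" "X \<noteq> {}" "z \<in> \<Omega>"
  shows "Min (dist z ` X) \<le> fill_distance \<Omega> X"
  unfolding fill_distance_def
proof (rule cSUP_upper[OF \<open>z \<in> \<Omega>\<close>])
  obtain x0 where x0: "x0 \<in> X" using assms by auto
  obtain B where B: "\<And>x. x \<in> \<Omega> \<Longrightarrow> dist x0 x \<le> B"
    using \<open>bounded \<Omega>\<close> by (meson bounded_any_center)
  show "bdd_above ((\<lambda>x. Min (dist x ` X)) ` \<Omega>)"
  proof (rule bdd_aboveI2)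
    fix x assume "x \<in> \<Omega>"
    have "Min (dist x ` X) \<le> dist x x0" using x0 assms by (intro Min_le) auto
    also have "\<dots> \<le> B" using B[OF \<open>x \<in> \<Omega>\<close>] by (simp add: dist_commute)
    finally show "Min (dist x ` X) \<le> B" .
  qed
qed

text \<open>Well-separated points of a segment in \<open>\<Omega>\<close> have distinct nearest design points.\<close>

lemma eventually_many_design_points_near:
  fixes \<Omega> :: "'a::euclidean_space set" and xs :: "nat \<Rightarrow> nat \<Rightarrow> 'a"
  assumes "convex \<Omega>" "bounded \<Omega>" and xy: "x \<in> \<Omega>" "y \<in> \<Omega>" "x \<noteq> y"
    and ne: "\<And>m. 0 < n m"
    and fill: "(\<lambda>m. fill_distance \<Omega> (xs m ` {..<n m})) \<longlonglongrightarrow> 0"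
    and "0 < \<delta>" "0 < N"
  shows "\<forall>\<^sub>F m in sequentially. \<exists>S\<subseteq>{..<n m}. card S = N \<and> (\<forall>j\<in>S. dist (xs m j) x < \<delta>)"
proof -
  define D where "D = dist x y"
  have D: "0 < D" using xy by (simp add: D_def)
  \<comment> \<open>The cap 1 keeps the points below on the segment from \<open>x\<close> to
    \<open>y\<close>; the other bound keeps them within \<open>\<delta> / 2\<close> of
    \<open>x\<close>.\<close>
  define t where "t = min 1 (\<delta> / (2 * D))"
  have t: "0 < t" "t \<le> 1" "t * D \<le> \<delta> / 2"
    using D \<open>0 < \<delta>\<close> by (auto simp: t_def min_def field_simps)
  \<comment> \<open>The spacing of \<open>N\<close> equidistant points on the initial piece of
    length \<open>t * D\<close>. A design point within \<open>\<eta> / 2\<close> of one of them is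
    still within \<open>\<delta>\<close> of \<open>x\<close>, because
    \<open>\<eta> \<le> \<delta> / 2\<close>.\<close>
  define \<eta> where "\<eta> = t * D / real N"
  have "t * D / real N \<le> t * D / 1"
    using t D \<open>0 < N\<close> by (intro divide_left_mono) auto
  hence "t * D / real N \<le> \<delta> / 2" using t by linarith
  hence \<eta>: "0 < \<eta>" "\<eta> \<le> \<delta> / 2"
    using t D \<open>0 < N\<close> by (simp_all add: \<eta>_def)
  define z where "z i = x + (t * (real i / real N)) *\<^sub>R (y - x)" for i
  have z_in: "z i \<in> \<Omega>" if "i < N" for i
  proof -
    have "t * (real i / real N) \<le> 1 * 1" using that t by (intro mult_mono) auto
    moreover have "z i = (1 - t * (real i / real N)) *\<^sub>R x + (t * (real i / real N)) *\<^sub>R y"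
      by (simp add: z_def algebra_simps)
    ultimately show ?thesis using convexD_alt[OF \<open>convex \<Omega>\<close> xy(1,2)] t by simp
  qed
  have z_near: "dist (z i) x \<le> \<delta> / 2" if "i < N" for i
  proof -
    have "dist (z i) x = t * D * (real i / real N)"
      using t D by (simp add: z_def dist_norm D_def norm_minus_commute abs_mult)
    also have "\<dots> \<le> t * D * 1" using that t D by (intro mult_left_mono) auto
    finally show ?thesis using t by simp
  qed
  have z_sep: "\<eta> \<le> dist (z i) (z j)" if "i \<noteq> j" for i j
  proof -
    have "z i - z j = (t * ((real i - real j) / real N)) *\<^sub>R (y - x)"
      by (simp add: z_def algebra_simps diff_divide_distrib)
    hence "dist (z i) (z j) = \<eta> * \<bar>real i - real j\<bar>"
      using t by (simp add: dist_norm D_def norm_minus_commute abs_mult \<eta>_def)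
    moreover have "1 \<le> \<bar>real i - real j\<bar>" using that by linarith
    ultimately show ?thesis using \<eta> by simp
  qed
  have "\<forall>\<^sub>F m in sequentially. fill_distance \<Omega> (xs m ` {..<n m}) < \<eta> / 2"
    using order_tendstoD(2)[OF fill, of "\<eta> / 2"] \<eta> by simp
  then show ?thesis
  proof eventually_elim
    case (elim m)
    let ?X = "xs m ` {..<n m}"
    have "\<exists>j<n m. dist (z i) (xs m j) < \<eta> / 2" if "i < N" for i
    proof -
      have X: "finite ?X" "?X \<noteq> {}" using ne[of m] by auto
      have "Min (dist (z i) ` ?X) \<in> dist (z i) ` ?X" using X by (intro Min_in) auto
      moreover have "Min (dist (z i) ` ?X) < \<eta> / 2"
        using Min_dist_le_fill_distance[OF \<open>bounded \<Omega>\<close> X z_in[OF that]] elim by simp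
      ultimately show ?thesis by auto
    qed
    then obtain j where j: "\<And>i. i < N \<Longrightarrow> j i < n m \<and> dist (z i) (xs m (j i)) < \<eta> / 2"
      by metis
    have "inj_on j {..<N}"
    proof (rule inj_onI, rule ccontr)
      fix a b assume ab: "a \<in> {..<N}" "b \<in> {..<N}" "j a = j b" "a \<noteq> b"
      have "dist (z a) (z b) \<le> dist (z a) (xs m (j a)) + dist (z b) (xs m (j a))"
        by (rule dist_triangle2)
      also have "\<dots> < \<eta>" using j[of a] j[of b] ab by simp
      finally show False using z_sep[OF ab(4)] by simp
    qed
    hence "card (j ` {..<N}) = N" by (simp add: card_image)
    moreover have "dist (xs m (j i)) x < \<delta>" if "i < N" for i
      using dist_triangle[of "xs m (j i)" x "z i"] j[OF that] z_near[OF that] \<eta>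
      by (simp add: dist_commute)
    ultimately show ?case using j by (intro exI[of _ "j ` {..<N}"]) auto
  qed
qed

section \<open>The correlation smoothed by two independent errors\<close>

text \<open>A single integral over the product law instead of the iterated one in
  \<open>Psi_S\<close>: dominated convergence and the exchange of the two errors then apply
  directly.\<close>

definition smoothed_corr :: "('a::euclidean_space \<Rightarrow> real) \<Rightarrow> 'a measure \<Rightarrow> 'a \<Rightarrow> real" where
  "smoothed_corr \<Psi> P h = (LINT u|(P \<Otimes>\<^sub>M P). \<Psi> (h + fst u - snd u))"

locale smearing = P: prob_space P for P :: "'a::euclidean_space measure" +
  fixes \<Psi> :: "'a \<Rightarrow> real"
  assumes sets_P [measurable_cong]: "sets P = sets borel"
    and cont: "continuous_on UNIV \<Psi>"
    and le_one: "\<bar>\<Psi> h\<bar> \<le> 1"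
begin

sublocale PP: pair_prob_space P P ..

lemma \<Psi>_measurable [measurable]: "\<Psi> \<in> borel_measurable borel"
  using cont by (rule borel_measurable_continuous_onI)

lemma smoothed_integrable: "integrable (P \<Otimes>\<^sub>M P) (\<lambda>u. \<Psi> (h + fst u - snd u))"
  by (rule PP.integrable_const_bound[where B = 1]) (auto simp: le_one)

lemma smoothed_corr_eq: "smoothed_corr \<Psi> P h = (LINT a|P. LINT b|P. \<Psi> (h + a - b))"
  using PP.integral_fst'[OF smoothed_integrable[of h]] by (simp add: smoothed_corr_def)

text \<open>Dominated convergence along sequences, with the constant 1 as majorant.\<close>

lemma isCont_smoothed_corr: "isCont (smoothed_corr \<Psi> P) h"
  unfolding continuous_at_sequentially comp_def
proof (intro allI impI)
  fix X assume X: "X \<longlonglongrightarrow> h"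
  show "(\<lambda>i. smoothed_corr \<Psi> P (X i)) \<longlonglongrightarrow> smoothed_corr \<Psi> P h"
    unfolding smoothed_corr_def
  proof (rule integral_dominated_convergence[where w = "\<lambda>_. 1"])
    show "AE u in P \<Otimes>\<^sub>M P. (\<lambda>i. \<Psi> (X i + fst u - snd u)) \<longlonglongrightarrow> \<Psi> (h + fst u - snd u)"
      using cont X by (intro AE_I2 continuous_on_tendsto_compose[OF cont] tendsto_intros) auto
  qed (auto simp: le_one)
qed

text \<open>Exchanging the two identically distributed errors reverses the sign of their difference,
  and \<Psi> is even.\<close>

lemma smoothed_corr_uminus:
  assumes "\<And>h. \<Psi> (- h) = \<Psi> h"
  shows "smoothed_corr \<Psi> P (- h) = smoothed_corr \<Psi> P h"
proof -
  have "smoothed_corr \<Psi> P h = (LINT u|(P \<Otimes>\<^sub>M P). \<Psi> (h + snd u - fst u))"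
    using PP.integral_product_swap[of "\<lambda>u. \<Psi> (h + fst u - snd u)"]
    by (simp add: smoothed_corr_def case_prod_beta')
  also have "\<dots> = smoothed_corr \<Psi> P (- h)"
    unfolding smoothed_corr_def
    by (intro Bochner_Integration.integral_cong refl) (subst assms[symmetric], simp add: algebra_simps)
  finally show ?thesis by simp
qed

text \<open>Without atoms, independent errors almost surely differ, and \<open>\<Psi> < 1\<close> off the origin.\<close>

lemma smoothed_corr_0_less:
  assumes less: "\<And>h. h \<noteq> 0 \<Longrightarrow> \<Psi> h < 1" and atomless: "\<And>a. measure P {a} = 0"
  shows "smoothed_corr \<Psi> P 0 < 1"
proof (rule ccontr)
  have int: "integrable (P \<Otimes>\<^sub>M P) (\<lambda>u. 1 - \<Psi> (0 + fst u - snd u))"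
    by (intro Bochner_Integration.integrable_diff smoothed_integrable) simp
  have nonneg: "0 \<le> 1 - \<Psi> h" for h using le_one[of h] by auto
  assume "\<not> smoothed_corr \<Psi> P 0 < 1"
  moreover have eq: "(LINT u|(P \<Otimes>\<^sub>M P). 1 - \<Psi> (0 + fst u - snd u)) = 1 - smoothed_corr \<Psi> P 0"
    unfolding smoothed_corr_def
    by (subst Bochner_Integration.integral_diff) (use smoothed_integrable[of 0] in \<open>auto simp: PP.prob_space\<close>)
  moreover have "0 \<le> (LINT u|(P \<Otimes>\<^sub>M P). 1 - \<Psi> (0 + fst u - snd u))"
    by (intro Bochner_Integration.integral_nonneg nonneg)
  ultimately have "(LINT u|(P \<Otimes>\<^sub>M P). 1 - \<Psi> (0 + fst u - snd u)) = 0"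
    by linarith
  hence "AE u in P \<Otimes>\<^sub>M P. 1 - \<Psi> (0 + fst u - snd u) = 0"
    using integral_nonneg_eq_0_iff_AE[OF int AE_I2] nonneg by blast
  hence "AE u in P \<Otimes>\<^sub>M P. fst u = snd u"
  proof eventually_elim
    case (elim u)
    thus ?case using less[of "fst u - snd u"] by force
  qed
  hence "AE a in P. AE b in P. a = b"
    by (auto dest: PP.AE_pair)
  \<comment> \<open>On a probability space a property that holds almost everywhere holds somewhere.
    All mass of \<open>P\<close> would then sit at the single point \<open>a\<close>.\<close>
  then obtain a where "AE b in P. a = b"
    using P.AE_False by (smt (verit) AE_cong)
  hence "AE b in P. b \<in> {a}" by eventually_elim simp
  hence "measure P {a} = 1"
    by (subst P.prob_eq_1) (simp_all add: sets_P)
  thus False using atomless by simp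
qed

end

section \<open>Second moments of the process at random locations\<close>

text \<open>The two measures agree on rectangles. Independence is assumed between families of events
  containing the preimages, matching \<open>independent_of_process\<close>, which speaks of
  generated \<sigma>-algebras.\<close>

lemma (in prob_space) distr_pair_indep_set:
  assumes Z [measurable]: "random_variable S Z" and Y [measurable]: "random_variable F Y"
    and V: "\<And>A. A \<in> sets S \<Longrightarrow> Z -` A \<inter> space M \<in> V"
    and U: "\<And>A. A \<in> sets F \<Longrightarrow> Y -` A \<inter> space M \<in> U"
    and ind: "indep_set U V"
  shows "distr M (S \<Otimes>\<^sub>M F) (\<lambda>\<omega>. (Z \<omega>, Y \<omega>)) = distr M S Z \<Otimes>\<^sub>M distr M F Y"
proof (rule sym, rule pair_measure_eqI)
  show "sigma_finite_measure (distr M S Z)" "sigma_finite_measure (distr M F Y)"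
    using prob_space_distr[OF Z] prob_space_distr[OF Y] by (auto dest: prob_space_imp_sigma_finite)
  fix A B assume "A \<in> sets (distr M S Z)" "B \<in> sets (distr M F Y)"
  hence AB [measurable]: "A \<in> sets S" "B \<in> sets F" by auto
  have "(\<lambda>\<omega>. (Z \<omega>, Y \<omega>)) -` (A \<times> B) \<inter> space M = (Y -` B \<inter> space M) \<inter> (Z -` A \<inter> space M)"
    by auto
  moreover have "prob ((Y -` B \<inter> space M) \<inter> (Z -` A \<inter> space M))
      = prob (Y -` B \<inter> space M) * prob (Z -` A \<inter> space M)"
    using ind U[OF AB(2)] V[OF AB(1)] by (auto simp: indep_sets2_eq)
  ultimately show "emeasure (distr M S Z) A * emeasure (distr M F Y) B
      = emeasure (distr M (S \<Otimes>\<^sub>M F) (\<lambda>\<omega>. (Z \<omega>, Y \<omega>))) (A \<times> B)"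
    by (simp add: emeasure_distr emeasure_eq_measure ennreal_mult mult.commute)
qed simp

locale smeared_process = prob_space M + smearing P \<Psi>
  for M :: "'w measure" and P :: "'a::euclidean_space measure" and \<Psi> :: "'a \<Rightarrow> real" +
  fixes f :: "'a \<Rightarrow> 'w \<Rightarrow> real" and \<sigma> :: real
  assumes sigma: "0 < \<sigma>"
    and Psi_0: "\<Psi> 0 = 1"
    and random: "f s \<in> borel_measurable M"
    and measurable_process: "measurable_process M f"
    and square_int: "integrable M (\<lambda>\<omega>. (f s \<omega>)\<^sup>2)"
    and moment: "(LINT \<omega>|M. f s \<omega> * f t \<omega>) = \<sigma>\<^sup>2 * \<Psi> (s - t)"
begin

text \<open>The measure \<open>M\<close> restricted to the events of the process. Pairing an error
  with the identity map into this space makes independence from the whole process a product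
  law.\<close>

definition N :: "'w measure" where "N = distr M (process_algebra M f) (\<lambda>\<omega>. \<omega>)"

lemma measurable_id: "(\<lambda>\<omega>. \<omega>) \<in> M \<rightarrow>\<^sub>M process_algebra M f"
  unfolding process_algebra_def
  by (rule measurable_vimage_algebra2) (auto intro: measurable_PiM_single' random)

lemma sets_N [measurable_cong]: "sets N = sets (process_algebra M f)"
  by (simp add: N_def)

sublocale N: prob_space N
  unfolding N_def by (rule prob_space_distr) (rule measurable_id)

lemma joint_measurable: "(\<lambda>(s, \<omega>). f s \<omega>) \<in> borel_measurable (borel \<Otimes>\<^sub>M N)"
  using measurable_process unfolding measurable_process_def by measurable

lemma process_measurable [measurable (raw)]:
  assumes "g \<in> borel_measurable L" "h \<in> L \<rightarrow>\<^sub>M N"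
  shows "(\<lambda>u. f (g u) (h u)) \<in> borel_measurable L"
  using measurable_compose[OF measurable_Pair[OF assms] joint_measurable] by simp

lemma
  shows square_int_N: "integrable N (\<lambda>\<omega>. (f s \<omega>)\<^sup>2)"
    and moment_N: "(LINT \<omega>|N. f s \<omega> * f t \<omega>) = \<sigma>\<^sup>2 * \<Psi> (s - t)"
proof -
  have *: "f s \<in> borel_measurable (process_algebra M f)" for s
    unfolding measurable_cong_sets[OF sets_N[symmetric] refl] by measurable
  show "integrable N (\<lambda>\<omega>. (f s \<omega>)\<^sup>2)" unfolding N_def
    using * by (subst integrable_distr_eq[OF measurable_id]) (auto intro: square_int)
  show "(LINT \<omega>|N. f s \<omega> * f t \<omega>) = \<sigma>\<^sup>2 * \<Psi> (s - t)" unfolding N_def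
    using * by (subst integral_distr[OF measurable_id]) (auto simp: moment)
qed

text \<open>By Tonelli: for each fixed location the inner integral is the constant
  \<open>\<sigma>\<^sup>2\<close>, by stationarity.\<close>

lemma mixed_square_integrable:
  assumes "prob_space Q" and g [measurable]: "g \<in> borel_measurable Q"
  shows "integrable (Q \<Otimes>\<^sub>M N) (\<lambda>u. (f (g (fst u)) (snd u))\<^sup>2)"
proof -
  interpret Q: prob_space Q by fact
  interpret QN: pair_prob_space Q N ..
  show ?thesis
  proof (rule QN.Fubini_integrable)
    have "(LINT \<omega>|N. norm ((f (g (fst (a, \<omega>))) (snd (a, \<omega>)))\<^sup>2)) = \<sigma>\<^sup>2" for a
      using moment_N[of "g a" "g a"] Psi_0 by (simp add: power2_eq_square)
    thus "integrable Q (\<lambda>a. LINT \<omega>|N. norm ((f (g (fst (a, \<omega>))) (snd (a, \<omega>)))\<^sup>2))"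
      by simp
  qed (auto simp: square_int_N)
qed

lemma
  assumes Q: "prob_space Q" and [measurable]: "g \<in> borel_measurable Q" "h \<in> borel_measurable Q"
  shows mixed_integrable: "integrable (Q \<Otimes>\<^sub>M N) (\<lambda>u. f (g (fst u)) (snd u) * f (h (fst u)) (snd u))"
    and mixed_moment: "(LINT u|(Q \<Otimes>\<^sub>M N). f (g (fst u)) (snd u) * f (h (fst u)) (snd u))
      = \<sigma>\<^sup>2 * (LINT a|Q. \<Psi> (g a - h a))"
proof -
  interpret Q: prob_space Q by fact
  interpret QN: pair_prob_space Q N ..
  show *: "integrable (Q \<Otimes>\<^sub>M N) (\<lambda>u. f (g (fst u)) (snd u) * f (h (fst u)) (snd u))"
  proof (rule Bochner_Integration.integrable_bound)
    show "integrable (Q \<Otimes>\<^sub>M N) (\<lambda>u. (f (g (fst u)) (snd u))\<^sup>2 + (f (h (fst u)) (snd u))\<^sup>2)"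
      by (intro Bochner_Integration.integrable_add mixed_square_integrable Q) auto
    \<comment> \<open>Products of process values are dominated by the sum of their squares, which is
      integrable.\<close>
    have "\<bar>a * b\<bar> \<le> a\<^sup>2 + b\<^sup>2" for a b :: real
      using sum_squares_bound[of "\<bar>a\<bar>" "\<bar>b\<bar>"] mult_nonneg_nonneg[of "\<bar>a\<bar>" "\<bar>b\<bar>"]
      unfolding abs_mult power2_abs by linarith
    thus "AE u in Q \<Otimes>\<^sub>M N. norm (f (g (fst u)) (snd u) * f (h (fst u)) (snd u))
        \<le> norm ((f (g (fst u)) (snd u))\<^sup>2 + (f (h (fst u)) (snd u))\<^sup>2)"
      by simp
  qed measurable
  show "(LINT u|(Q \<Otimes>\<^sub>M N). f (g (fst u)) (snd u) * f (h (fst u)) (snd u))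
      = \<sigma>\<^sup>2 * (LINT a|Q. \<Psi> (g a - h a))"
    \<comment> \<open>Conditioning on the locations leaves the covariance at two fixed
      points.\<close>
    using QN.integral_fst'[OF *] by (simp add: moment_N)
qed

text \<open>\<open>\<sigma>\<^sup>2\<close> times the double sum is the second moment of
  \<open>\<Sum>i. c i * (LINT a|P. f (z i + a))\<close>.\<close>

lemma smoothed_corr_psd:
  assumes I: "finite I"
  shows "0 \<le> (\<Sum>i\<in>I. \<Sum>j\<in>I. c i * c j * smoothed_corr \<Psi> P (z i - z j))"
proof -
  define F where "F a \<omega> = (\<Sum>i\<in>I. c i * f (z i + a) \<omega>)" for a \<omega>
  have [measurable]: "(\<lambda>u. F (g u) (h u)) \<in> borel_measurable L"
    if [measurable]: "g \<in> borel_measurable L" "h \<in> L \<rightarrow>\<^sub>M N" for g h and L :: "'z measure"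
    unfolding F_def by measurable
  interpret R: pair_prob_space "P \<Otimes>\<^sub>M P" N ..
  let ?t = "\<lambda>i j u. f (z i + fst (fst u)) (snd u) * f (z j + snd (fst u)) (snd u)"
  have int: "integrable ((P \<Otimes>\<^sub>M P) \<Otimes>\<^sub>M N) (?t i j)" for i j
    by (rule mixed_integrable) (auto intro: PP.prob_space_axioms)
  have val: "integral\<^sup>L ((P \<Otimes>\<^sub>M P) \<Otimes>\<^sub>M N) (?t i j) = \<sigma>\<^sup>2 * smoothed_corr \<Psi> P (z i - z j)" for i j
    by (subst mixed_moment) (auto intro: PP.prob_space_axioms simp: smoothed_corr_def algebra_simps)
  have FF: "F (fst (fst u)) (snd u) * F (snd (fst u)) (snd u) = (\<Sum>i\<in>I. \<Sum>j\<in>I. c i * c j * ?t i j u)" for u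
    unfolding F_def sum_product by (simp add: mult_ac)
  have intF: "integrable ((P \<Otimes>\<^sub>M P) \<Otimes>\<^sub>M N) (\<lambda>u. F (fst (fst u)) (snd u) * F (snd (fst u)) (snd u))"
    unfolding FF by (intro Bochner_Integration.integrable_sum integrable_mult_right int)
  have "0 \<le> (LINT \<omega>|N. (LINT u|(P \<Otimes>\<^sub>M P). F (fst u) \<omega> * F (snd u) \<omega>))"
  proof (rule integral_nonneg_AE)
    \<comment> \<open>Joint integrability makes almost every section integrable. On such a section
      the two error coordinates separate, and the double integral is a square.\<close>
    have "AE \<omega> in N. integrable (P \<Otimes>\<^sub>M P) (\<lambda>u. F (fst u) \<omega> * F (snd u) \<omega>)"
      using R.AE_integrable_snd[of "\<lambda>u \<omega>. F (fst u) \<omega> * F (snd u) \<omega>"] intF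
      by (simp add: case_prod_beta')
    thus "AE \<omega> in N. 0 \<le> (LINT u|(P \<Otimes>\<^sub>M P). F (fst u) \<omega> * F (snd u) \<omega>)"
    proof eventually_elim
      case (elim \<omega>)
      have "(LINT u|(P \<Otimes>\<^sub>M P). F (fst u) \<omega> * F (snd u) \<omega>) = (LINT a|P. F a \<omega>)\<^sup>2"
        using PP.integral_fst'[OF elim] by (simp add: power2_eq_square)
      thus ?case by simp
    qed
  qed
  also have "\<dots> = (LINT u|((P \<Otimes>\<^sub>M P) \<Otimes>\<^sub>M N). F (fst (fst u)) (snd u) * F (snd (fst u)) (snd u))"
    using R.integral_snd[of "\<lambda>u \<omega>. F (fst u) \<omega> * F (snd u) \<omega>"] intF
    by (simp add: case_prod_beta')
  also have "\<dots> = (\<Sum>i\<in>I. \<Sum>j\<in>I. c i * c j * (\<sigma>\<^sup>2 * smoothed_corr \<Psi> P (z i - z j)))"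
    unfolding FF using int by (simp add: Bochner_Integration.integral_sum val)
  also have "\<dots> = \<sigma>\<^sup>2 * (\<Sum>i\<in>I. \<Sum>j\<in>I. c i * c j * smoothed_corr \<Psi> P (z i - z j))"
    by (simp add: sum_distrib_left mult_ac)
  finally show ?thesis using sigma by (simp add: zero_le_mult_iff)
qed

lemma Psi_uminus: "\<Psi> (- h) = \<Psi> h"
  using moment[of 0 h] moment[of h 0] sigma by (simp add: mult.commute)

text \<open>Semidefiniteness at the two points \<open>h\<close> and \<open>0\<close> with weights 1
  and -1 reads \<open>0 \<le> 2 * S 0 - 2 * S h\<close>, where \<open>S\<close> is the smoothed
  correlation.\<close>

lemma smoothed_corr_le: "smoothed_corr \<Psi> P h \<le> smoothed_corr \<Psi> P 0"
  using smoothed_corr_psd[of "{0, 1}" "\<lambda>i. if i = 0 then 1 else - 1" "\<lambda>i::nat. if i = 0 then h else 0"]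
    smoothed_corr_uminus[of h] Psi_uminus by simp

text \<open>The variable \<open>U\<close> carries all errors involved. Its pair with the identity
  has the product law of \<open>U\<close> and \<open>N\<close>, so the moments over the product
  space transfer to \<open>M\<close>.\<close>

lemma
  assumes U [measurable]: "random_variable S U"
    and sub: "\<And>A. A \<in> sets S \<Longrightarrow> U -` A \<inter> space M \<in> V"
    and ind: "indep_set (sets (process_algebra M f)) V"
    and [measurable]: "g \<in> borel_measurable S" "h \<in> borel_measurable S"
  shows shifted_integrable: "integrable M (\<lambda>\<omega>. f (g (U \<omega>)) \<omega> * f (h (U \<omega>)) \<omega>)"
    and shifted_moment: "(LINT \<omega>|M. f (g (U \<omega>)) \<omega> * f (h (U \<omega>)) \<omega>)
      = \<sigma>\<^sup>2 * (LINT a|distr M S U. \<Psi> (g a - h a))"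
proof -
  let ?F = "\<lambda>u. f (g (fst u)) (snd u) * f (h (fst u)) (snd u)"
  have law: "distr M (S \<Otimes>\<^sub>M process_algebra M f) (\<lambda>\<omega>. (U \<omega>, \<omega>)) = distr M S U \<Otimes>\<^sub>M N"
    unfolding N_def
  proof (rule distr_pair_indep_set[OF U measurable_id sub _ ind])
    fix A assume "A \<in> sets (process_algebra M f)"
    thus "(\<lambda>\<omega>. \<omega>) -` A \<inter> space M \<in> sets (process_algebra M f)"
      using sets.sets_into_space[of A "process_algebra M f"]
      by (simp add: process_algebra_def Int_absorb2)
  qed
  have Q: "prob_space (distr M S U)" by (rule prob_space_distr) fact
  have [measurable]: "(\<lambda>\<omega>. (U \<omega>, \<omega>)) \<in> M \<rightarrow>\<^sub>M S \<Otimes>\<^sub>M process_algebra M f"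
    by (intro measurable_Pair U measurable_id)
  have F: "?F \<in> borel_measurable (S \<Otimes>\<^sub>M process_algebra M f)"
    by measurable
  have "integrable (distr M S U \<Otimes>\<^sub>M N) ?F" by (rule mixed_integrable[OF Q]) auto
  thus "integrable M (\<lambda>\<omega>. f (g (U \<omega>)) \<omega> * f (h (U \<omega>)) \<omega>)"
    unfolding law[symmetric] by (subst (asm) integrable_distr_eq) (auto intro: F)
  have "(LINT u|(distr M S U \<Otimes>\<^sub>M N). ?F u) = \<sigma>\<^sup>2 * (LINT a|distr M S U. \<Psi> (g a - h a))"
    by (rule mixed_moment[OF Q]) auto
  thus "(LINT \<omega>|M. f (g (U \<omega>)) \<omega> * f (h (U \<omega>)) \<omega>) = \<sigma>\<^sup>2 * (LINT a|distr M S U. \<Psi> (g a - h a))"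
    unfolding law[symmetric] by (subst (asm) integral_distr) (auto intro: F)
qed

end

section \<open>Linear predictors in the presence of a nugget\<close>

context smeared_process
begin

text \<open>The mean squared error of the linear predictor with weights \<open>c\<close>, in units
  of \<open>\<sigma>\<^sup>2\<close>. The diagonal entry is 1 because an observation shares its
  error with itself.\<close>

definition relative_mspe :: "nat \<Rightarrow> (nat \<Rightarrow> 'a) \<Rightarrow> 'a \<Rightarrow> (nat \<Rightarrow> real) \<Rightarrow> real" where
  "relative_mspe n z x c = 1 - 2 * (\<Sum>i<n. c i * smoothed_corr \<Psi> P (x - z i)) +
     (\<Sum>i<n. \<Sum>j<n. c i * c j * (if i = j then 1 else smoothed_corr \<Psi> P (z i - z j)))"

lemma nugget_form:
  fixes n :: nat
  shows "(\<Sum>i<n. \<Sum>j<n. c i * c j * (if i = j then 1 else smoothed_corr \<Psi> P (z i - z j))) =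
   (\<Sum>i<n. \<Sum>j<n. c i * c j * smoothed_corr \<Psi> P (z i - z j)) +
     (1 - smoothed_corr \<Psi> P 0) * (\<Sum>i<n. (c i)\<^sup>2)" (is "?l = _")
proof -
  have "?l = (\<Sum>i<n. \<Sum>j<n. c i * c j * smoothed_corr \<Psi> P (z i - z j) +
      (if i = j then c i * c j * (1 - smoothed_corr \<Psi> P 0) else 0))"
    by (intro sum.cong refl) (auto simp: algebra_simps)
  also have "\<dots> = (\<Sum>i<n. \<Sum>j<n. c i * c j * smoothed_corr \<Psi> P (z i - z j)) +
      (\<Sum>i<n. c i * c i * (1 - smoothed_corr \<Psi> P 0))"
    by (simp add: sum.distrib)
  finally show ?thesis by (simp add: sum_distrib_left power2_eq_square mult_ac)
qed

text \<open>Strict positivity comes from the nugget, so repeated design points, which make the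
  smoothed matrix singular, cause no degeneracy.\<close>

lemma nugget_pd:
  fixes n :: nat
  assumes "smoothed_corr \<Psi> P 0 < 1" "\<exists>i<n. c i \<noteq> 0"
  shows "0 < (\<Sum>i<n. \<Sum>j<n. c i * c j * (if i = j then 1 else smoothed_corr \<Psi> P (z i - z j)))"
proof -
  from assms(2) obtain i where "i < n" "c i \<noteq> 0" by auto
  hence "0 < (\<Sum>i<n. (c i)\<^sup>2)" by (intro sum_pos2[of _ i]) auto
  with assms(1) smoothed_corr_psd[of "{..<n}" c z] show ?thesis
    unfolding nugget_form by (intro add_nonneg_pos mult_pos_pos) auto
qed

text \<open>Apart from nonnegative nugget terms, the error minus its lower bound is the semidefinite
  form at \<open>x\<close> with weight 1 and at the \<open>z i\<close> with weights
  \<open>- c i\<close>. The index \<open>None\<close> stands for the point \<open>x\<close>.\<close>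

lemma relative_mspe_ge:
  assumes "smoothed_corr \<Psi> P 0 \<le> 1"
  shows "1 - smoothed_corr \<Psi> P 0 \<le> relative_mspe n z x c"
proof -
  let ?S = "smoothed_corr \<Psi> P" and ?d = "\<lambda>i. case i of None \<Rightarrow> 1 | Some i \<Rightarrow> - c i"
  have even: "?S (a - b) = ?S (b - a)" for a b
    using smoothed_corr_uminus[of "b - a"] Psi_uminus by simp
  have "0 \<le> (\<Sum>i\<in>insert None (Some ` {..<n}). \<Sum>j\<in>insert None (Some ` {..<n}).
      ?d i * ?d j * ?S (case_option x z i - case_option x z j))"
    by (rule smoothed_corr_psd) simp
  also have "\<dots> = ?S 0 - 2 * (\<Sum>i<n. c i * ?S (x - z i)) + (\<Sum>i<n. \<Sum>j<n. c i * c j * ?S (z i - z j))"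
    by (subst sum.insert; simp add: sum.reindex sum.distrib sum_negf sum_subtractf)+
       (simp add: even[of _ x])
  finally show ?thesis
    using assms unfolding relative_mspe_def nugget_form
    by (smt (verit) mult_nonneg_nonneg sum_nonneg zero_le_power2)
qed

text \<open>For the average over \<open>S\<close>, closeness bounds the cross term, the maximum of
  the smoothed correlation at 0 bounds the double sum, and the squared weights add up to
  \<open>1 / k\<close> in the nugget term.\<close>

lemma relative_mspe_average_le:
  fixes k :: nat
  assumes S: "S \<subseteq> {..<n}" "card S = k" "0 < k"
    and near: "\<And>i. i \<in> S \<Longrightarrow> smoothed_corr \<Psi> P 0 - \<eta> \<le> smoothed_corr \<Psi> P (x - z i)"
    and le1: "smoothed_corr \<Psi> P 0 \<le> 1"
  shows "relative_mspe n z x (\<lambda>i. if i \<in> S then 1 / k else 0)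
    \<le> (1 - smoothed_corr \<Psi> P 0) + 2 * \<eta> + (1 - smoothed_corr \<Psi> P 0) / k"
proof -
  let ?S = "smoothed_corr \<Psi> P" and ?c = "\<lambda>i. if i \<in> S then 1 / real k else 0"
  have restrict: "(\<Sum>i<n. if i \<in> S then g i else 0) = sum g S" for g :: "nat \<Rightarrow> real"
    using S(1) by (simp add: sum.If_cases Int_absorb1)
  have "?S 0 - \<eta> = (\<Sum>i\<in>S. 1 / k * (?S 0 - \<eta>))" using S by simp
  also have "\<dots> \<le> (\<Sum>i\<in>S. 1 / k * ?S (x - z i))"
    by (intro sum_mono mult_left_mono near) auto
  also have "\<dots> = (\<Sum>i<n. ?c i * ?S (x - z i))"
    by (subst restrict[symmetric]) (intro sum.cong, auto)
  finally have 1: "?S 0 - \<eta> \<le> (\<Sum>i<n. ?c i * ?S (x - z i))" .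
  have sum1: "(\<Sum>i<n. ?c i) = 1" using restrict[of "\<lambda>_. 1 / k"] S by simp
  have "(\<Sum>i<n. \<Sum>j<n. ?c i * ?c j * ?S (z i - z j)) \<le> (\<Sum>i<n. \<Sum>j<n. ?c i * ?c j * ?S 0)"
    by (intro sum_mono mult_left_mono smoothed_corr_le) auto
  also have "\<dots> = (\<Sum>i<n. ?c i) * (\<Sum>i<n. ?c i) * ?S 0"
    unfolding sum_product by (simp add: sum_distrib_right)
  finally have 2: "(\<Sum>i<n. \<Sum>j<n. ?c i * ?c j * ?S (z i - z j)) \<le> ?S 0" unfolding sum1 by simp
  have "(\<Sum>i<n. (?c i)\<^sup>2) = (\<Sum>i<n. if i \<in> S then (1 / k)\<^sup>2 else 0)" by (intro sum.cong) auto
  also have "\<dots> = 1 / k" using S by (simp add: restrict power2_eq_square)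
  finally have "(\<Sum>i<n. (?c i)\<^sup>2) = 1 / k" .
  with 1 2 show ?thesis unfolding relative_mspe_def nugget_form by simp
qed

text \<open>For equal indices the common error cancels in the difference of locations; for distinct
  ones the errors are independent and smooth the correlation. The distinction is by index and not by
  location, so replicates are covered.\<close>

lemma
  assumes e: "indep_vars (\<lambda>_. borel) e J" and law: "\<And>i. i \<in> J \<Longrightarrow> distr M borel (e i) = P"
    and ind: "independent_of_process M f J e" and ij: "i \<in> J" "j \<in> J"
  shows observed_integrable: "integrable M (\<lambda>\<omega>. f (a + e i \<omega>) \<omega> * f (b + e j \<omega>) \<omega>)"
    and observed_moment: "(LINT \<omega>|M. f (a + e i \<omega>) \<omega> * f (b + e j \<omega>) \<omega>) =
      \<sigma>\<^sup>2 * (if i = j then \<Psi> (a - b) else smoothed_corr \<Psi> P (a - b))"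
proof -
  let ?W = "vimage_algebra (space M) (\<lambda>\<omega>. \<lambda>j\<in>J. e j \<omega>) (\<Pi>\<^sub>M j\<in>J. (borel :: 'a measure))"
  have ind': "indep_set (sets (process_algebra M f)) (sets ?W)"
    using ind by (simp add: independent_of_process_def)
  have e_W: "e i \<in> ?W \<rightarrow>\<^sub>M borel" if "i \<in> J" for i
  proof -
    have "(\<lambda>\<omega>. (\<lambda>j\<in>J. e j \<omega>) i) \<in> ?W \<rightarrow>\<^sub>M borel"
      by (rule measurable_compose[OF measurable_vimage_algebra1 measurable_component_singleton])
         (use that in \<open>auto simp: space_PiM\<close>)
    thus ?thesis using that by simp
  qed
  have e_M: "random_variable borel (e i)" if "i \<in> J" for i
    using e that by (simp add: indep_vars_def)
  have sub: "U -` A \<inter> space M \<in> sets ?W" if "U \<in> ?W \<rightarrow>\<^sub>M S" "A \<in> sets S" for U A and S :: "'z measure"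
    using measurable_sets[OF that] by simp
  have "integrable M (\<lambda>\<omega>. f (a + e i \<omega>) \<omega> * f (b + e j \<omega>) \<omega>) \<and>
    (LINT \<omega>|M. f (a + e i \<omega>) \<omega> * f (b + e j \<omega>) \<omega>) =
      \<sigma>\<^sup>2 * (if i = j then \<Psi> (a - b) else smoothed_corr \<Psi> P (a - b))"
  proof (cases "i = j")
    case True
    note * = e_M[OF ij(1)] sub[OF e_W[OF ij(1)]] ind'
    have "(LINT u|distr M borel (e i). \<Psi> (a + u - (b + u))) = \<Psi> (a - b)"
      using law[OF ij(1)] by (simp add: P.prob_space)
    thus ?thesis
      using shifted_integrable[OF *, of "\<lambda>u. a + u" "\<lambda>u. b + u"]
        shifted_moment[OF *, of "\<lambda>u. a + u" "\<lambda>u. b + u"] True by simp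
  next
    case False
    let ?U = "\<lambda>\<omega>. (e i \<omega>, e j \<omega>)"
    have U: "random_variable (borel \<Otimes>\<^sub>M borel) ?U" "?U \<in> ?W \<rightarrow>\<^sub>M borel \<Otimes>\<^sub>M borel"
      using ij by (auto intro!: measurable_Pair e_M e_W)
    note * = U(1) sub[OF U(2)] ind'
    have "indep_var borel (e i) borel (e j)"
      using indep_var_compose[OF indep_var_restrict[OF e, of "{i}" "{j}"],
          of "\<lambda>g. g i" borel "\<lambda>g. g j" borel] ij False by (simp add: comp_def)
    hence "distr M (borel \<Otimes>\<^sub>M borel) ?U = P \<Otimes>\<^sub>M P"
      by (simp add: indep_var_distribution_eq law ij)
    hence "(LINT u|distr M (borel \<Otimes>\<^sub>M borel) ?U. \<Psi> (a + fst u - (b + snd u))) = smoothed_corr \<Psi> P (a - b)"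
      by (simp add: smoothed_corr_def algebra_simps)
    thus ?thesis
      using shifted_integrable[OF *, of "\<lambda>u. a + fst u" "\<lambda>u. b + snd u"]
        shifted_moment[OF *, of "\<lambda>u. a + fst u" "\<lambda>u. b + snd u"] False by simp
  qed
  thus "integrable M (\<lambda>\<omega>. f (a + e i \<omega>) \<omega> * f (b + e j \<omega>) \<omega>)"
    "(LINT \<omega>|M. f (a + e i \<omega>) \<omega> * f (b + e j \<omega>) \<omega>) =
      \<sigma>\<^sup>2 * (if i = j then \<Psi> (a - b) else smoothed_corr \<Psi> P (a - b))" by auto
qed

text \<open>Expand the square and insert the second moments. The error at the predicted point has
  index \<open>None\<close>, so it is independent of every observation error, even when
  \<open>x\<close> is itself a design point.\<close>

lemma linear_predictor_mspe:
  assumes e: "indep_vars (\<lambda>_. borel) e (insert None (Some ` {..<n}))"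
    and law: "\<And>i. i \<in> insert None (Some ` {..<n}) \<Longrightarrow> distr M borel (e i) = P"
    and ind: "independent_of_process M f (insert None (Some ` {..<n})) e"
  shows "(LINT \<omega>|M. (f (x + e None \<omega>) \<omega> - (\<Sum>i<n. c i * f (z i + e (Some i) \<omega>) \<omega>))\<^sup>2)
    = \<sigma>\<^sup>2 * relative_mspe n z x c"
proof -
  let ?S = "smoothed_corr \<Psi> P"
  let ?y = "\<lambda>\<omega>. f (x + e None \<omega>) \<omega>" and ?Y = "\<lambda>i \<omega>. f (z i + e (Some i) \<omega>) \<omega>"
  note m = observed_integrable[OF e law ind] observed_moment[OF e law ind]
  have i0: "integrable M (\<lambda>\<omega>. ?y \<omega> * ?y \<omega>)" and v0: "(LINT \<omega>|M. ?y \<omega> * ?y \<omega>) = \<sigma>\<^sup>2"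
    using m[of None None x x] Psi_0 by simp_all
  have i1: "integrable M (\<lambda>\<omega>. ?y \<omega> * ?Y i \<omega>)"
    and v1: "(LINT \<omega>|M. ?y \<omega> * ?Y i \<omega>) = \<sigma>\<^sup>2 * ?S (x - z i)" if "i < n" for i
    using m[of None "Some i" x "z i"] that by simp_all
  have i2: "integrable M (\<lambda>\<omega>. ?Y i \<omega> * ?Y j \<omega>)"
    and v2: "(LINT \<omega>|M. ?Y i \<omega> * ?Y j \<omega>) = \<sigma>\<^sup>2 * (if i = j then 1 else ?S (z i - z j))"
    if "i < n" "j < n" for i j
    using m[of "Some i" "Some j" "z i" "z j"] that Psi_0 by (auto split: if_splits)
  have j1: "integrable M (\<lambda>\<omega>. \<Sum>i<n. 2 * c i * (?y \<omega> * ?Y i \<omega>))"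
    using i1 by (intro Bochner_Integration.integrable_sum integrable_mult_right) auto
  have j2: "integrable M (\<lambda>\<omega>. \<Sum>i<n. \<Sum>j<n. c i * c j * (?Y i \<omega> * ?Y j \<omega>))"
    using i2 by (intro Bochner_Integration.integrable_sum integrable_mult_right) auto
  have "(?y \<omega> - (\<Sum>i<n. c i * ?Y i \<omega>))\<^sup>2 = ?y \<omega> * ?y \<omega> - (\<Sum>i<n. 2 * c i * (?y \<omega> * ?Y i \<omega>))
      + (\<Sum>i<n. \<Sum>j<n. c i * c j * (?Y i \<omega> * ?Y j \<omega>))" for \<omega>
    unfolding power2_diff unfolding power2_eq_square sum_product by (simp add: sum_distrib_left mult_ac)
  hence "(LINT \<omega>|M. (?y \<omega> - (\<Sum>i<n. c i * ?Y i \<omega>))\<^sup>2) =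
      (LINT \<omega>|M. ?y \<omega> * ?y \<omega> - (\<Sum>i<n. 2 * c i * (?y \<omega> * ?Y i \<omega>))
      + (\<Sum>i<n. \<Sum>j<n. c i * c j * (?Y i \<omega> * ?Y j \<omega>)))" by simp
  also have "\<dots> = (LINT \<omega>|M. ?y \<omega> * ?y \<omega>) - (LINT \<omega>|M. (\<Sum>i<n. 2 * c i * (?y \<omega> * ?Y i \<omega>)))
      + (LINT \<omega>|M. (\<Sum>i<n. \<Sum>j<n. c i * c j * (?Y i \<omega> * ?Y j \<omega>)))"
    using i0 j1 j2 by simp
  also have "(LINT \<omega>|M. (\<Sum>i<n. 2 * c i * (?y \<omega> * ?Y i \<omega>))) = (\<Sum>i<n. 2 * c i * (LINT \<omega>|M. ?y \<omega> * ?Y i \<omega>))"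
    using i1 by (subst Bochner_Integration.integral_sum) auto
  also have "(LINT \<omega>|M. (\<Sum>i<n. \<Sum>j<n. c i * c j * (?Y i \<omega> * ?Y j \<omega>)))
      = (\<Sum>i<n. \<Sum>j<n. c i * c j * (LINT \<omega>|M. ?Y i \<omega> * ?Y j \<omega>))"
  proof -
    have "(LINT \<omega>|M. (\<Sum>i<n. \<Sum>j<n. c i * c j * (?Y i \<omega> * ?Y j \<omega>)))
        = (\<Sum>i<n. LINT \<omega>|M. (\<Sum>j<n. c i * c j * (?Y i \<omega> * ?Y j \<omega>)))"
      using i2
      by (intro Bochner_Integration.integral_sum Bochner_Integration.integrable_sum integrable_mult_right) auto
    also have "\<dots> = (\<Sum>i<n. \<Sum>j<n. LINT \<omega>|M. c i * c j * (?Y i \<omega> * ?Y j \<omega>))"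
      using i2 by (intro sum.cong refl Bochner_Integration.integral_sum integrable_mult_right) auto
    finally show ?thesis by simp
  qed
  also have "(LINT \<omega>|M. ?y \<omega> * ?y \<omega>) - (\<Sum>i<n. 2 * c i * (LINT \<omega>|M. ?y \<omega> * ?Y i \<omega>))
      + (\<Sum>i<n. \<Sum>j<n. c i * c j * (LINT \<omega>|M. ?Y i \<omega> * ?Y j \<omega>))
    = \<sigma>\<^sup>2 - (\<Sum>i<n. 2 * c i * (\<sigma>\<^sup>2 * ?S (x - z i)))
      + (\<Sum>i<n. \<Sum>j<n. c i * c j * (\<sigma>\<^sup>2 * (if i = j then 1 else ?S (z i - z j))))"
    using v0 v1 v2 by simp
  also have "\<dots> = \<sigma>\<^sup>2 * relative_mspe n z x c"
    unfolding relative_mspe_def by (simp add: sum_distrib_left algebra_simps)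
  finally show ?thesis .
qed

end

section \<open>The error of KALEN and its limit\<close>

lemma Psi_S_eq_smoothed_corr:
  fixes \<Psi> p :: "'a::euclidean_space \<Rightarrow> real"
  assumes sm: "smearing (density lborel (\<lambda>v. ennreal (p v))) \<Psi>"
    and p [measurable]: "p \<in> borel_measurable borel" and nonneg: "\<And>v. 0 \<le> p v"
  shows "Psi_S \<Psi> p = smoothed_corr \<Psi> (density lborel (\<lambda>v. ennreal (p v)))"
proof
  fix h
  let ?P = "density lborel (\<lambda>v. ennreal (p v))"
  interpret smearing ?P \<Psi> by fact
  have "(LINT b|?P. \<Psi> (h + a - b)) = (LINT b|lborel. p b * \<Psi> (h + a - b))" for a
    using nonneg by (subst integral_density) auto
  moreover have "(LINT a|?P. g a) = (LINT a|lborel. p a * g a)" if "g \<in> borel_measurable borel" for g :: "'a \<Rightarrow> real"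
    using nonneg that by (subst integral_density) auto
  moreover have "(\<lambda>a. LINT b|?P. \<Psi> (h + a - b)) \<in> borel_measurable borel"
    by measurable
  ultimately have "smoothed_corr \<Psi> ?P h = (LINT a|lborel. p a * (LINT b|lborel. p b * \<Psi> (h + a - b)))"
    by (simp add: smoothed_corr_eq)
  also have "\<dots> = Psi_S \<Psi> p h"
    unfolding Psi_S_def by (subst integral_mult_right_zero[symmetric]) (simp add: mult_ac)
  finally show "Psi_S \<Psi> p h = smoothed_corr \<Psi> ?P h" ..
qed

theorem theorem2p1:
  fixes M :: "'w measure"
    and f :: "'a::euclidean_space \<Rightarrow> 'w \<Rightarrow> real"
    and \<Omega> :: "'a set"
    and \<sigma> \<nu> C :: real
    and \<Psi> p :: "'a \<Rightarrow> real"
    and \<phi> :: "real \<Rightarrow> real"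
    and n :: "nat \<Rightarrow> nat"
    and xs :: "nat \<Rightarrow> nat \<Rightarrow> 'a"
    and \<epsilon> :: "nat \<Rightarrow> nat \<Rightarrow> 'w \<Rightarrow> 'a"
    and \<epsilon>\<^sub>0 :: "'w \<Rightarrow> 'a"
    and x :: 'a
  assumes prob: "prob_space M"
    and Omega: "convex \<Omega>" "compact \<Omega>"
    and sigma: "0 < \<sigma>"
    and Psi: "integrable lborel \<Psi>" "continuous_on UNIV \<Psi>" "positive_definite \<Psi>" "\<Psi> 0 = 1"
    and process: "gaussian_process M f" "measurable_process M f"
    and mean: "\<And>s. integral\<^sup>L M (f s) = 0"
    and cov: "\<And>s t. covariance M (f s) (f t) = \<sigma>\<^sup>2 * \<Psi> (s - t)"
    and density: "continuous_on UNIV p" "\<And>v. 0 \<le> p v"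
    and errors: "\<And>m. iid_location_errors M p (insert None (Some ` {..<n m})) (case_option \<epsilon>\<^sub>0 (\<epsilon> m))"
    and indep: "\<And>m. independent_of_process M f (insert None (Some ` {..<n m})) (case_option \<epsilon>\<^sub>0 (\<epsilon> m))"
    and A1_radial: "\<And>s t. \<Psi> (s - t) = \<phi> (norm (s - t))"
    and A1_decreasing: "\<And>r. 0 \<le> r \<Longrightarrow> 0 < \<phi> r" "strict_antimono_on {0..} \<phi>" "\<phi> 0 = 1"
    and A1_embedding: "real DIM('a) / 2 < \<nu>" "native_embeds_in_sobolev \<Omega> \<Psi> \<nu>"
    and design: "\<And>m. xs m ` {..<n m} \<subseteq> \<Omega>" "\<And>m. 2 \<le> card (xs m ` {..<n m})"
    and A2: "0 < C"
      "\<And>m. fill_distance \<Omega> (xs m ` {..<n m}) \<le> C * separation_radius (xs m ` {..<n m})"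
    and fill: "(\<lambda>m. fill_distance \<Omega> (xs m ` {..<n m})) \<longlonglongrightarrow> 0"
    and x: "x \<in> \<Omega>"
  shows "(\<forall>m. invertible_mat (kalen_K \<sigma> \<Psi> p (n m) (xs m)) \<and>
            kalen_mspe M f \<sigma> \<Psi> p (n m) (xs m) (\<epsilon> m) \<epsilon>\<^sub>0 x =
              \<sigma>\<^sup>2 * \<Psi> (x - x) -
              scalar_prod (kalen_r \<sigma> \<Psi> p (n m) (xs m) x)
                (inverse_mat (kalen_K \<sigma> \<Psi> p (n m) (xs m)) *\<^sub>v kalen_r \<sigma> \<Psi> p (n m) (xs m) x)) \<and>
         (\<lambda>m. kalen_mspe M f \<sigma> \<Psi> p (n m) (xs m) (\<epsilon> m) \<epsilon>\<^sub>0 x)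
           \<longlonglongrightarrow> \<sigma>\<^sup>2 * (\<Psi> (x - x) - Psi_S \<Psi> p (x - x))"
proof -
  interpret prob_space M by fact
  define P where "P = density lborel (\<lambda>v. ennreal (p v))"
  have p [measurable]: "p \<in> borel_measurable borel"
    using density(1) by (rule borel_measurable_continuous_onI)
  have dist_e: "distributed M lborel (case_option \<epsilon>\<^sub>0 (\<epsilon> m) i) (\<lambda>v. ennreal (p v))"
    if "i \<in> insert None (Some ` {..<n m})" for m i
    using errors[of m] that unfolding iid_location_errors_def by blast
  have law: "distr M borel (case_option \<epsilon>\<^sub>0 (\<epsilon> m) i) = P"
    if "i \<in> insert None (Some ` {..<n m})" for m i
    using distributed_distr_eq_density[OF dist_e[OF that]] unfolding P_def
    by (simp cong: distr_cong)
  \<comment> \<open>Strict decrease of \<phi> from \<open>\<phi> 0 = 1\<close> makes the origin the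
    only point of full correlation, which is what forces a positive nugget.\<close>
  have Psi_less: "0 < \<Psi> h" "h \<noteq> 0 \<Longrightarrow> \<Psi> h < 1" for h
    using A1_radial[of h 0] A1_decreasing(1)[of "norm h"] A1_decreasing(3)
      monotone_onD[OF A1_decreasing(2), of 0 "norm h"] by auto
  have Psi_le: "\<bar>\<Psi> h\<bar> \<le> 1" for h
    using Psi_less[of h] Psi(4) by (cases "h = 0") auto
  have "prob_space P"
    using prob_space_distr[of "\<epsilon>\<^sub>0" borel] law[of None] distributed_measurable[OF dist_e[of None]]
    by simp
  then have sm: "smearing P \<Psi>"
    unfolding smearing_def smearing_axioms_def using Psi(2) Psi_le by (simp add: P_def)
  have f_meas: "f s \<in> borel_measurable M" for s
    using process(1)[unfolded gaussian_process_def, rule_format, of "{s}" "\<lambda>_. 1"]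
    by (simp add: gaussian_variable_def)
  have f_cov: "(LINT \<omega>|M. f s \<omega> * f t \<omega>) = \<sigma>\<^sup>2 * \<Psi> (s - t)" for s t
    using cov[of s t] by (simp add: covariance_def mean)
  \<comment> \<open>A non-integrable function has Bochner integral 0, whereas this second moment is
    \<open>\<sigma>\<^sup>2 > 0\<close>.\<close>
  have f_square: "integrable M (\<lambda>\<omega>. (f s \<omega>)\<^sup>2)" for s
    using f_cov[of s s] sigma Psi(4) not_integrable_integral_eq
    by (fastforce simp: power2_eq_square)
  interpret smeared_process M P \<Psi> f \<sigma>
    by (intro smeared_process.intro smeared_process_axioms.intro)
       (use prob sm sigma Psi(4) f_meas process(2) f_square f_cov in auto)
  let ?S = "smoothed_corr \<Psi> P"
  have PsiS: "Psi_S \<Psi> p = ?S"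
    using Psi_S_eq_smoothed_corr[OF sm[unfolded P_def] p density(2)] by (simp add: P_def)
  \<comment> \<open>The error law has a density, and points are Lebesgue null sets.\<close>
  have "emeasure P {a} = 0" for a
    unfolding P_def by (subst emeasure_density) (auto simp: nn_integral_0_iff_AE AE_lborel_singleton intro: AE_mp[OF AE_lborel_singleton[of a]])
  hence S0: "?S 0 < 1" using Psi_less by (intro smoothed_corr_0_less) (auto simp: measure_def)
  have S_even: "?S (a - b) = ?S (b - a)" for a b
    using smoothed_corr_uminus[of "b - a"] Psi_uminus by simp

  \<comment> \<open>For each design: the error formula, the lower bound by the nugget, and
    optimality among all linear predictors. The limit uses nothing else about KALEN.\<close>
  have main: "invertible_mat (kalen_K \<sigma> \<Psi> p (n m) (xs m)) \<and>
      kalen_mspe M f \<sigma> \<Psi> p (n m) (xs m) (\<epsilon> m) \<epsilon>\<^sub>0 x =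
        \<sigma>\<^sup>2 - scalar_prod (kalen_r \<sigma> \<Psi> p (n m) (xs m) x)
          (inverse_mat (kalen_K \<sigma> \<Psi> p (n m) (xs m)) *\<^sub>v kalen_r \<sigma> \<Psi> p (n m) (xs m) x) \<and>
      \<sigma>\<^sup>2 * (1 - ?S 0) \<le> kalen_mspe M f \<sigma> \<Psi> p (n m) (xs m) (\<epsilon> m) \<epsilon>\<^sub>0 x \<and>
      (\<forall>c. kalen_mspe M f \<sigma> \<Psi> p (n m) (xs m) (\<epsilon> m) \<epsilon>\<^sub>0 x
        \<le> \<sigma>\<^sup>2 * relative_mspe (n m) (xs m) x c)" for m
  proof -
    define k where "k i j = (if i = j then 1 else ?S (xs m i - xs m j))" for i j
    define A where "A = kalen_K \<sigma> \<Psi> p (n m) (xs m)"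
    define r where "r = kalen_r \<sigma> \<Psi> p (n m) (xs m) x"
    \<comment> \<open>By symmetry of the inverse these are the coefficients of the data in the
      predictor.\<close>
    define w where "w = inverse_mat A *\<^sub>v r"
    have A_eq: "A = mat (n m) (n m) (\<lambda>(i, j). \<sigma>\<^sup>2 * k i j)"
      unfolding A_def kalen_K_def k_def PsiS Psi(4) by (auto intro!: cong_mat)
    have pd: "0 < (\<Sum>i<n m. \<Sum>j<n m. c i * c j * k i j)" if "\<exists>i<n m. c i \<noteq> 0" for c
      unfolding k_def by (rule nugget_pd[OF S0 that])
    have psd: "0 \<le> (\<Sum>i<n m. \<Sum>j<n m. c i * c j * k i j)" for c
      using pd[of c] by (cases "\<exists>i<n m. c i \<noteq> 0") auto
    have pd': "0 < (\<Sum>i<n m. \<Sum>j<n m. c i * c j * (\<sigma>\<^sup>2 * k i j))" if "\<exists>i<n m. c i \<noteq> 0" for c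
    proof -
      have "(\<Sum>i<n m. \<Sum>j<n m. c i * c j * (\<sigma>\<^sup>2 * k i j)) = \<sigma>\<^sup>2 * (\<Sum>i<n m. \<Sum>j<n m. c i * c j * k i j)"
        by (simp add: sum_distrib_left mult_ac)
      thus ?thesis using pd[OF that] sigma by simp
    qed
    note inv = inverse_mat_positive_definite[of "n m" "\<lambda>i j. \<sigma>\<^sup>2 * k i j", OF pd', folded A_eq]
    have A: "A \<in> carrier_mat (n m) (n m)" by (simp add: A_eq)
    have r: "r \<in> carrier_vec (n m)" by (simp add: r_def kalen_r_def)
    have w: "w \<in> carrier_vec (n m)" unfolding w_def using inv(4) r by simp
    have k_sym: "k i j = k j i" for i j by (simp add: k_def S_even)
    have A_sym: "transpose_mat A = A"
      by (rule eq_matI) (auto simp: A_eq k_sym)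
    have Aw: "A *\<^sub>v w = r"
      unfolding w_def using assoc_mult_mat_vec[OF A inv(4) r] inv(2) r by simp
    \<comment> \<open>The normal equations: \<open>A *\<^sub>v w = r\<close> divided by
      \<open>\<sigma>\<^sup>2\<close>.\<close>
    have sol: "(\<Sum>j<n m. k i j * w $ j) = ?S (x - xs m i)" if "i < n m" for i
    proof -
      have "\<sigma>\<^sup>2 * (\<Sum>j<n m. k i j * w $ j) = (A *\<^sub>v w) $ i"
        using that w by (simp add: A_eq scalar_prod_def lessThan_atLeast0 sum_distrib_left mult_ac)
      also have "\<dots> = \<sigma>\<^sup>2 * ?S (x - xs m i)"
        unfolding Aw using that by (simp add: r_def kalen_r_def PsiS)
      finally show ?thesis using sigma by simp
    qed
    have pred: "kalen_predictor \<sigma> \<Psi> p (n m) (xs m) x (observations f (n m) (xs m) (\<epsilon> m) \<omega>)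
        = (\<Sum>i<n m. w $ i * f (xs m i + \<epsilon> m i \<omega>) \<omega>)" for \<omega>
    proof -
      let ?Y = "observations f (n m) (xs m) (\<epsilon> m) \<omega>"
      have "scalar_prod r (inverse_mat A *\<^sub>v ?Y) = scalar_prod w ?Y"
        unfolding w_def using inv r A A_sym
        by (intro scalar_prod_inverse_mat_symmetric[of A "n m"]) (auto simp: observations_def)
      thus ?thesis
        by (simp add: kalen_predictor_def A_def r_def scalar_prod_def observations_def lessThan_atLeast0)
    qed
    have mspe: "kalen_mspe M f \<sigma> \<Psi> p (n m) (xs m) (\<epsilon> m) \<epsilon>\<^sub>0 x
        = \<sigma>\<^sup>2 * relative_mspe (n m) (xs m) x (\<lambda>i. w $ i)"
      using linear_predictor_mspe[OF _ law indep, of m x "\<lambda>i. w $ i" "xs m"] errors[of m]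
      unfolding kalen_mspe_def pred iid_location_errors_def by simp
    have min1: "(\<Sum>i<n m. \<Sum>j<n m. w $ i * w $ j * k i j) = (\<Sum>i<n m. w $ i * ?S (x - xs m i))"
      by (rule quadratic_form_minimum(1)) (fact k_sym psd sol)+
    have min2: "(\<Sum>i<n m. \<Sum>j<n m. w $ i * w $ j * k i j) - 2 * (\<Sum>i<n m. w $ i * ?S (x - xs m i))
        \<le> (\<Sum>i<n m. \<Sum>j<n m. c i * c j * k i j) - 2 * (\<Sum>i<n m. c i * ?S (x - xs m i))" for c
      by (rule quadratic_form_minimum(2)) (fact k_sym psd sol)+
    have rel: "relative_mspe (n m) (xs m) x c = 1 - 2 * (\<Sum>i<n m. c i * ?S (x - xs m i))
        + (\<Sum>i<n m. \<Sum>j<n m. c i * c j * k i j)" for c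
      by (simp add: relative_mspe_def k_def)
    \<comment> \<open>At the minimiser the quadratic term equals the linear one and cancels half of
      the doubled cross term.\<close>
    have "relative_mspe (n m) (xs m) x (\<lambda>i. w $ i) = 1 - (\<Sum>i<n m. w $ i * ?S (x - xs m i))"
      using min1 unfolding rel by simp
    moreover have "scalar_prod r w = \<sigma>\<^sup>2 * (\<Sum>i<n m. w $ i * ?S (x - xs m i))"
      using w by (simp add: scalar_prod_def r_def kalen_r_def PsiS lessThan_atLeast0 sum_distrib_left mult_ac)
    ultimately have "kalen_mspe M f \<sigma> \<Psi> p (n m) (xs m) (\<epsilon> m) \<epsilon>\<^sub>0 x = \<sigma>\<^sup>2 - scalar_prod r w"
      by (simp add: mspe right_diff_distrib)
    moreover have "\<sigma>\<^sup>2 * relative_mspe (n m) (xs m) x (\<lambda>i. w $ i)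
        \<le> \<sigma>\<^sup>2 * relative_mspe (n m) (xs m) x c" for c
      using min2[of c] unfolding rel by (intro mult_left_mono) auto
    moreover have "\<sigma>\<^sup>2 * (1 - ?S 0) \<le> \<sigma>\<^sup>2 * relative_mspe (n m) (xs m) x (\<lambda>i. w $ i)"
      using S0 by (intro mult_left_mono relative_mspe_ge) auto
    ultimately show ?thesis
      using inv(1) mspe unfolding A_def[symmetric] r_def[symmetric] w_def[symmetric] by simp
  qed

  have n_pos: "0 < n m" for m using design(2)[of m] by (cases "n m") auto
  \<comment> \<open>Two distinct design points exist, so one differs from \<open>x\<close>; it gives
    a nondegenerate segment in \<Omega> starting at \<open>x\<close>.\<close>
  obtain y where y: "y \<in> \<Omega>" "x \<noteq> y"
  proof -
    have "\<not> xs 0 ` {..<n 0} \<subseteq> {x}"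
      using design(2)[of 0] card_mono[of "{x}" "xs 0 ` {..<n 0}"] by auto
    thus ?thesis using design(1)[of 0] that by auto
  qed
  have "(\<lambda>m. kalen_mspe M f \<sigma> \<Psi> p (n m) (xs m) (\<epsilon> m) \<epsilon>\<^sub>0 x) \<longlonglongrightarrow> \<sigma>\<^sup>2 * (1 - ?S 0)"
  proof (rule order_tendstoI)
    fix b assume "b < \<sigma>\<^sup>2 * (1 - ?S 0)"
    thus "\<forall>\<^sub>F m in sequentially. b < kalen_mspe M f \<sigma> \<Psi> p (n m) (xs m) (\<epsilon> m) \<epsilon>\<^sub>0 x"
      using main by (intro always_eventually allI) (meson less_le_trans)
  next
    fix b assume b: "\<sigma>\<^sup>2 * (1 - ?S 0) < b"
    \<comment> \<open>A quarter of the gap between \<open>b / \<sigma>\<^sup>2\<close> and the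
      limit: the average costs \<open>2 * \<eta>\<close> for distance and less than \<eta> for the
      nugget over \<open>N\<close> terms, below the available \<open>4 * \<eta>\<close>.\<close>
    define \<eta> where "\<eta> = (b / \<sigma>\<^sup>2 - (1 - ?S 0)) / 4"
    have \<eta>: "0 < \<eta>" using b sigma by (simp add: \<eta>_def field_simps)
    obtain N :: nat where N: "0 < N" "(1 - ?S 0) / N < \<eta>"
    proof -
      obtain N :: nat where "(1 - ?S 0) / \<eta> < N" using reals_Archimedean2 by blast
      moreover from this have "0 < real N" using S0 \<eta> by (smt (verit) divide_pos_pos)
      ultimately show ?thesis using that \<eta> by (simp add: field_simps)
    qed
    \<comment> \<open>Continuity of the smoothed correlation at 0 says how near the averaged design
      points must be.\<close>
    obtain \<delta> where \<delta>: "0 < \<delta>" "\<And>h. norm h < \<delta> \<Longrightarrow> dist (?S h) (?S 0) < \<eta>"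
      using isCont_smoothed_corr[of 0] \<eta> unfolding continuous_at_eps_delta by auto
    show "\<forall>\<^sub>F m in sequentially. kalen_mspe M f \<sigma> \<Psi> p (n m) (xs m) (\<epsilon> m) \<epsilon>\<^sub>0 x < b"
      using eventually_many_design_points_near[OF Omega(1) compact_imp_bounded[OF Omega(2)] x y n_pos fill \<delta>(1) N(1)]
    proof eventually_elim
      case (elim m)
      then obtain S where S: "S \<subseteq> {..<n m}" "card S = N" "\<And>j. j \<in> S \<Longrightarrow> dist (xs m j) x < \<delta>"
        by auto
      have "?S 0 - \<eta> \<le> ?S (x - xs m j)" if "j \<in> S" for j
        using \<delta>(2)[of "x - xs m j"] S(3)[OF that] by (simp add: dist_norm norm_minus_commute)
      from relative_mspe_average_le[OF S(1,2) N(1) this] S0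
      have "relative_mspe (n m) (xs m) x (\<lambda>i. if i \<in> S then 1 / N else 0)
          \<le> (1 - ?S 0) + 2 * \<eta> + (1 - ?S 0) / N" by simp
      also have "\<dots> < (1 - ?S 0) + 4 * \<eta>" using N(2) \<eta> by linarith
      also have "\<dots> = b / \<sigma>\<^sup>2" by (simp only: \<eta>_def times_divide_eq_right nonzero_mult_div_cancel_left[OF zero_neq_numeral[symmetric]])
      finally have "\<sigma>\<^sup>2 * relative_mspe (n m) (xs m) x (\<lambda>i. if i \<in> S then 1 / N else 0) < b"
        using sigma by (simp add: field_simps)
      thus ?case using main[of m] by (meson le_less_trans)
    qed
  qed
  with main Psi(4) show ?thesis by (simp add: PsiS)
qed

end
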